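(* Let $0\le\alpha<1$. Let $f=h+\overline{g}$ be harmonic in $\mathbb{D}$, where $h(z)=z+\sum_{n=2}^{\infty}a_nz^n$ and $g(z)=\sum_{n=2}^{\infty}b_nz^n$, and suppose that for all $n\ge 2$ $$|a_n|\le \frac{n+1}{2},\qquad |b_n|\le \frac{n-1}{2}.$$ Then for $D_f^{\epsilon}=zf_z-\epsilon\,\overline{z}f_{\overline{z}}$ ($|\epsilon|=1$): (1) the radius of full starlikeness of order $\alpha$ is $r_s(\alpha)$, where $r_s(\alpha)$ is the unique root in the interval $(0,1)$ of the equation $s_\alpha(r)=0$, with $$s_{\alpha}(r)=1-\alpha -6(2-\alpha) r+11(1-\alpha ) r^2- 8(1-\alpha) r^3+2(1-\alpha ) r^4;$$ (2) the (univalent) radius of fully starlikeness is $r_u\approx 0.0903331$, where $r_u$ is the unique root in the interval $(0,1)$ of the equation $$1 - 12 r + 11 r^2 - 8 r^3 + 2 r^4= 0.$$ All the results are sharp.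
   Context: $\mathbb{D}=\{z\in\mathbb{C}:|z|<1\}$. $\mathcal{H}$ is the class of complex-valued harmonic functions $f=h+\overline g$ on $\mathbb{D}$ with $h,g$ analytic in $\mathbb{D}$, $h(0)=g(0)=0$, $h'(0)=1$. $\mathcal{S}_H$ is the class of univalent sense-preserving $f\in\mathcal{H}$ (sense-preserving: $|g'(z)|<|h'(z)|$ in $\mathbb{D}$). For $f=h+\overline g$ and $|\epsilon|=1$, $D_f^{\epsilon}(z)=zf_z-\epsilon\,\overline z f_{\overline z}=zh'(z)-\epsilon\,\overline{zg'(z)}$. For $0\le\alpha<1$, a function $F\in\mathcal{S}_H$ is fully starlike of order $\alpha$ (in $\mathbb{D}$) if it maps every circle $|z|=r<1$ in a one-to-one manner onto a curve satisfying $\frac{\partial}{\partial\theta}\arg F(re^{i\theta})>\alpha$ for $0\le\theta<2\pi$, $0<r<1$; "fully starlike" means fully starlike of order $0$ (univalence is part of the definition, since $F\in\mathcal{S}_H$). For $r\in(0,1)$, $F$ has such a property in $|z|<r$ if $F_r(z)=r^{-1}F(rz)$ has it in $\mathbb{D}$. The radius of a property of $D_f^\epsilon$ is the number $\rho$ such that $D_f^\epsilon$ has the property in $|z|<\rho$ for every $f$ satisfying the hypotheses. "Sharp" means that $\rho$ cannot be replaced by a larger number with the conclusion still holding for all data allowed by the hypotheses. *)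

theory Defs
  imports "HOL-Complex_Analysis.Complex_Analysis"
begin

text \<open>The open unit disc is \<^term>\<open>ball 0 1 :: complex set\<close>. Functions on the disc are total
  functions on \<^typ>\<open>complex\<close>; their values outside the disc never matter below.\<close>

definition normalized_harmonic ::
    "(complex \<Rightarrow> complex) \<Rightarrow> (complex \<Rightarrow> complex) \<Rightarrow> (complex \<Rightarrow> complex) \<Rightarrow> bool" where
  "normalized_harmonic F h g \<longleftrightarrow>
     h holomorphic_on ball 0 1 \<and> g holomorphic_on ball 0 1 \<and>
     h 0 = 0 \<and> g 0 = 0 \<and> deriv h 0 = 1 \<and>
     (\<forall>z\<in>ball 0 1. F z = h z + cnj (g z))"

definition class_SH :: "(complex \<Rightarrow> complex) set" where
  "class_SH = {F. inj_on F (ball 0 1) \<and>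
     (\<exists>h g. normalized_harmonic F h g \<and>
            (\<forall>z\<in>ball 0 1. cmod (deriv g z) < cmod (deriv h z)))}"

text \<open>The argument of \<open>F (r * exp (\<i> * \<theta>))\<close> is a continuous branch \<open>\<phi>\<close> along the whole circle;
  the principal value \<^const>\<open>Arg\<close> would jump. All such branches differ by constants, so the
  derivative does not depend on the choice.\<close>

definition fully_starlike :: "real \<Rightarrow> (complex \<Rightarrow> complex) \<Rightarrow> bool" where
  "fully_starlike \<alpha> F \<longleftrightarrow> F \<in> class_SH \<and>
     (\<forall>r\<in>{0<..<1}. inj_on F (sphere 0 r) \<and>
       (\<exists>\<phi>::real \<Rightarrow> real. continuous_on UNIV \<phi> \<and>
          (\<forall>\<theta>. F (rcis r \<theta>) \<noteq> 0 \<and> F (rcis r \<theta>) = rcis (cmod (F (rcis r \<theta>))) (\<phi> \<theta>)) \<and>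
          (\<forall>\<theta>\<in>{0..<2*pi}. \<exists>D. (\<phi> has_real_derivative D) (at \<theta>) \<and> D > \<alpha>)))"

definition dilation :: "real \<Rightarrow> (complex \<Rightarrow> complex) \<Rightarrow> complex \<Rightarrow> complex" where
  "dilation r F = (\<lambda>z. F (of_real r * z) / of_real r)"

text \<open>Wirtinger derivatives: \<open>(f\<^sub>x - \<i> f\<^sub>y) / 2\<close> and \<open>(f\<^sub>x + \<i> f\<^sub>y) / 2\<close>.\<close>

definition wirtinger_z :: "(complex \<Rightarrow> complex) \<Rightarrow> complex \<Rightarrow> complex" where
  "wirtinger_z f z =
     (frechet_derivative f (at z) 1 - \<i> * frechet_derivative f (at z) \<i>) / 2"

definition wirtinger_zbar :: "(complex \<Rightarrow> complex) \<Rightarrow> complex \<Rightarrow> complex" where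
  "wirtinger_zbar f z =
     (frechet_derivative f (at z) 1 + \<i> * frechet_derivative f (at z) \<i>) / 2"

definition D_op :: "complex \<Rightarrow> (complex \<Rightarrow> complex) \<Rightarrow> complex \<Rightarrow> complex" where
  "D_op \<epsilon> f z = z * wirtinger_z f z - \<epsilon> * cnj z * wirtinger_zbar f z"

lemma D_op_harmonic:
  assumes h: "h holomorphic_on ball 0 1" and g: "g holomorphic_on ball 0 1"
    and f: "\<And>z. z \<in> ball 0 1 \<Longrightarrow> f z = h z + cnj (g z)" and z: "z \<in> ball 0 1"
  shows "D_op \<epsilon> f z = z * deriv h z - \<epsilon> * cnj (z * deriv g z)"
proof -
  have dh: "(h has_derivative (*) (deriv h z)) (at z)"
    and dg: "(g has_derivative (*) (deriv g z)) (at z)"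
    using holomorphic_derivI[OF h _ z] holomorphic_derivI[OF g _ z]
    by (auto simp: has_field_derivative_def)
  have "((\<lambda>w. h w + cnj (g w)) has_derivative (\<lambda>v. deriv h z * v + cnj (deriv g z * v))) (at z)"
    by (intro derivative_intros has_derivative_cnj dh dg)
  then have "(f has_derivative (\<lambda>v. deriv h z * v + cnj (deriv g z * v))) (at z)"
    by (rule has_derivative_transform_within_open[of _ _ _ UNIV "ball 0 1"]) (use f z in auto)
  then have "frechet_derivative f (at z) = (\<lambda>v. deriv h z * v + cnj (deriv g z * v))"
    by (rule frechet_derivative_at[symmetric])
  then show ?thesis
    by (simp add: D_op_def wirtinger_z_def wirtinger_zbar_def field_simps)
qed

definition coeff_class :: "(complex \<Rightarrow> complex) set" where
  "coeff_class = {f. \<exists>h g. \<exists>a b :: nat \<Rightarrow> complex.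
     h holomorphic_on ball 0 1 \<and> g holomorphic_on ball 0 1 \<and>
     (\<forall>z\<in>ball 0 1. f z = h z + cnj (g z)) \<and>
     a 0 = 0 \<and> a 1 = 1 \<and> b 0 = 0 \<and> b 1 = 0 \<and>
     (\<forall>z\<in>ball 0 1. (\<lambda>n. a n * z ^ n) sums h z) \<and>
     (\<forall>z\<in>ball 0 1. (\<lambda>n. b n * z ^ n) sums g z) \<and>
     (\<forall>n\<ge>2. cmod (a n) \<le> (real n + 1) / 2 \<and> cmod (b n) \<le> (real n - 1) / 2)}"

text \<open>\<open>\<rho>\<close> works for every member of \<open>C\<close>, and no larger radius in \<open>(0,1]\<close> does; radii above 1
  make no sense, as the functions are only given on the unit disc.\<close>

definition sharp_radius ::
    "((complex \<Rightarrow> complex) \<Rightarrow> bool) \<Rightarrow> ((complex \<Rightarrow> complex) \<Rightarrow> complex \<Rightarrow> complex) \<Rightarrow>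
     (complex \<Rightarrow> complex) set \<Rightarrow> real \<Rightarrow> bool" where
  "sharp_radius P T C \<rho> \<longleftrightarrow>
     0 < \<rho> \<and> \<rho> < 1 \<and>
     (\<forall>f\<in>C. P (dilation \<rho> (T f))) \<and>
     (\<forall>\<rho>'. \<rho> < \<rho>' \<and> \<rho>' \<le> 1 \<longrightarrow> \<not> (\<forall>f\<in>C. P (dilation \<rho>' (T f))))"

definition s_poly :: "real \<Rightarrow> real \<Rightarrow> real" where
  "s_poly \<alpha> r = 1 - \<alpha> - 6 * (2 - \<alpha>) * r + 11 * (1 - \<alpha>) * r^2 - 8 * (1 - \<alpha>) * r^3
                + 2 * (1 - \<alpha>) * r^4"

end

theory Submission
  imports Defs
begin

text \<open>
  Write \<open>D_f\<close> for \<^term>\<open>D_op \<epsilon> f\<close>. Since \<open>D_f(z) = z h'(z) - \<epsilon> cnj (z g'(z))\<close> is again harmonic, its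
  dilation to radius \<open>r\<close> is \<open>H + cnj G\<close> with Taylor coefficients of modulus
  \<open>|A_n| = n |a_n| r^(n-1)\<close> and \<open>|B_n| = n |b_n| r^(n-1)\<close>.

  The radius works because of a coefficient condition, \<open>fully_starlike_if_coefficient_sum\<close>: a
  harmonic \<open>F\<close> with \<open>A_1 = 1\<close>, \<open>B_1 = 0\<close> is fully starlike of order \<open>\<alpha>\<close> as soon as
  \<open>\<Sum>n\<ge>2. (n - \<alpha>)|A_n| + (n + \<alpha>)|B_n| \<le> 1 - \<alpha>\<close>. In each part of the definition the term \<open>z\<close> dominates
  the rest of the series: strictly, because for \<open>|z| < 1\<close> the rest carries an additional factor
  below 1. The derivative of the argument along a circle is \<open>Re (N / F)\<close> with
  \<open>N = z H' - cnj (z G')\<close>, and \<open>Re (N / F) > \<alpha>\<close> says that \<open>N - \<alpha> F + F\<close> has larger modulus than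
  \<open>N - \<alpha> F - F\<close>.

  Inserting the bounds on \<open>a_n\<close> and \<open>b_n\<close>, the weights collapse to \<open>n (n\<^sup>2 - \<alpha>) r^(n-1)\<close>. Summing
  \<open>n\<^sup>3 r^n\<close> and \<open>n r^n\<close> in closed form (\<open>extremal_weight_sums\<close>) shows that their sum over \<open>n \<ge> 2\<close> is
  at most \<open>1 - \<alpha>\<close> exactly when \<open>0 \<le> s_poly \<alpha> r\<close>. As \<^term>\<open>s_poly \<alpha>\<close> strictly decreases on \<open>[0, 1]\<close> from a positive to a negative
  value, its root is unique.

  For sharpness, choose \<open>a_n\<close> and \<open>b_n\<close> of the largest allowed modulus, with phases such that all
  terms of \<open>N - \<alpha> F\<close> other than the first are negative on the positive real axis. There \<open>N - \<alpha> F\<close> is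
  \<open>x\<close> times \<open>1 - \<alpha>\<close> minus the same sum of weights, \<open>N(x) - \<alpha> F(x) = x * s_poly \<alpha> x / (1 - x)^4\<close>. Just
  beyond the root this is negative while still \<open>F(x) > 0\<close>, whence the derivative of the argument is
  below \<open>\<alpha>\<close> (\<open>not_fully_starlike_extremal\<close>).
\<close>

section \<open>Power series\<close>

lemma sums_z_times_deriv:
  fixes c :: "nat \<Rightarrow> 'a::{real_normed_field,banach}"
  assumes "\<And>z. norm z < K \<Longrightarrow> (\<lambda>n. c n * z ^ n) sums f z"
    and "(f has_field_derivative D) (at z)" and "norm z < K"
  shows "(\<lambda>n. of_nat n * c n * z ^ n) sums (z * D)"
proof -
  have "(\<lambda>n. diffs c n * z ^ n) sums D"
    using termdiffs_sums_strong assms by blast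
  then have "(\<lambda>n. z * (diffs c n * z ^ n)) sums (z * D)"
    by (rule sums_mult)
  then have "(\<lambda>n. of_nat (Suc n) * c (Suc n) * z ^ Suc n) sums (z * D)"
    by (simp add: diffs_def mult_ac)
  then show ?thesis
    by (subst (asm) sums_Suc_iff) simp
qed

text \<open>Both sums arise from the geometric series by repeatedly applying the operator \<open>z d/dz\<close>, which
  multiplies the \<open>n\<close>-th coefficient by \<open>n\<close>.\<close>

lemma sums_n_cubed_and_n:
  fixes x :: real
  assumes "\<bar>x\<bar> < 1"
  shows "(\<lambda>n. real n ^ 3 * x ^ n) sums (x * (1 + 4 * x + x\<^sup>2) / (1 - x) ^ 4)"
    and "(\<lambda>n. real n * x ^ n) sums (x / (1 - x) ^ 2)"
proof -
  have s0: "(\<lambda>n. 1 * x ^ n) sums (1 / (1 - x))" if "norm x < 1" for x :: real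
    using geometric_sums[of x] that by simp
  have s1: "(\<lambda>n. of_nat n * 1 * x ^ n) sums (x / (1 - x) ^ 2)" if "norm x < 1" for x :: real
  proof -
    have "((\<lambda>x. 1 / (1 - x)) has_field_derivative 1 / (1 - x) ^ 2) (at x)"
      using that by (auto intro!: derivative_eq_intros simp: power2_eq_square)
    from sums_z_times_deriv[OF s0 this] that show ?thesis by simp
  qed
  have s2: "(\<lambda>n. of_nat n * (of_nat n * 1) * x ^ n) sums (x * (1 + x) / (1 - x) ^ 3)"
    if "norm x < 1" for x :: real
  proof -
    have "1 - x \<noteq> 0" using that by auto
    then have "((\<lambda>x. x / (1 - x) ^ 2) has_field_derivative (1 + x) / (1 - x) ^ 3) (at x)"
      by (auto intro!: derivative_eq_intros simp: divide_simps)
         (auto simp: algebra_simps power_numeral_reduce)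
    from sums_z_times_deriv[OF s1 this] that show ?thesis by simp
  qed
  have "1 - x \<noteq> 0" using assms by auto
  then have "((\<lambda>x. x * (1 + x) / (1 - x) ^ 3) has_field_derivative
      (1 + 4 * x + x\<^sup>2) / (1 - x) ^ 4) (at x)"
    by (auto intro!: derivative_eq_intros simp: divide_simps)
       (auto simp: algebra_simps power_numeral_reduce)
  from sums_z_times_deriv[OF s2 this] assms
  show "(\<lambda>n. real n ^ 3 * x ^ n) sums (x * (1 + 4 * x + x\<^sup>2) / (1 - x) ^ 4)"
    by (simp add: power3_eq_cube mult.assoc)
  show "(\<lambda>n. real n * x ^ n) sums (x / (1 - x) ^ 2)"
    using s1 assms by simp
qed

text \<open>The deviation of a harmonic series from its linear term. The sequence \<open>e\<close> is \<open>z^n\<close> in most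
  uses, but \<open>x^n - y^n\<close> in the proof of injectivity; the factor \<open>c\<close> takes up what depends on the
  points, so that \<open>m\<close> depends on the coefficients only.\<close>

lemma harmonic_remainder:
  fixes p q e :: "nat \<Rightarrow> complex" and m :: "nat \<Rightarrow> real"
  assumes "(\<lambda>n. p n * e n) sums P" and "(\<lambda>n. q n * e n) sums Q"
    and "p 0 = 0" "q 0 = 0" "q 1 = 0"
    and bound: "\<And>n. n \<ge> 2 \<Longrightarrow> (cmod (p n) + cmod (q n)) * cmod (e n) \<le> c * m n"
    and m: "summable (\<lambda>n. m (n + 2))"
  shows "cmod (P + cnj Q - p 1 * e 1) \<le> c * (\<Sum>n. m (n + 2))"
proof (rule norm_sums_le)
  let ?t = "\<lambda>n. p n * e n + cnj (q n * e n)"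
  have "?t sums (P + cnj Q)"
    using assms(1,2) by (intro sums_add) (simp_all only: sums_cnj)
  then have "(\<lambda>n. ?t (n + 2)) sums (P + cnj Q - (\<Sum>i<2. ?t i))"
    by (rule sums_split_initial_segment)
  then show "(\<lambda>n. ?t (n + 2)) sums (P + cnj Q - p 1 * e 1)"
    using assms(3-5) by (simp add: numeral_2_eq_2)
  show "(\<lambda>n. c * m (n + 2)) sums (c * (\<Sum>n. m (n + 2)))"
    using m by (intro sums_mult summable_sums)
  fix n
  have "cmod (?t (n + 2)) \<le> cmod (p (n + 2) * e (n + 2)) + cmod (q (n + 2) * e (n + 2))"
    by (metis complex_mod_cnj norm_triangle_ineq)
  also have "\<dots> = (cmod (p (n + 2)) + cmod (q (n + 2))) * cmod (e (n + 2))"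
    by (simp only: norm_mult distrib_right)
  also have "\<dots> \<le> c * m (n + 2)"
    by (rule bound) simp
  finally show "cmod (?t (n + 2)) \<le> c * m (n + 2)" .
qed

lemma norm_power_diff_le:
  fixes z w :: complex
  assumes "cmod z \<le> r" "cmod w \<le> r"
  shows "cmod (z ^ Suc k - w ^ Suc k) \<le> real (Suc k) * r ^ k * cmod (z - w)"
proof (induction k)
  case (Suc k)
  have r: "0 \<le> r" using assms(1) norm_ge_zero order_trans by blast
  have "z ^ Suc (Suc k) - w ^ Suc (Suc k) = z * (z ^ Suc k - w ^ Suc k) + w ^ Suc k * (z - w)"
    by (simp add: algebra_simps)
  also have "cmod \<dots> \<le> cmod z * cmod (z ^ Suc k - w ^ Suc k) + cmod w ^ Suc k * cmod (z - w)"
    by (metis norm_mult norm_power norm_triangle_ineq)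
  also have "\<dots> \<le> r * (real (Suc k) * r ^ k * cmod (z - w)) + r ^ Suc k * cmod (z - w)"
    using assms r Suc by (intro add_mono mult_mono power_mono) auto
  finally show ?case by (simp add: algebra_simps)
qed simp

section \<open>Arguments along circles\<close>

lemma rcis_has_vector_derivative:
  "((\<lambda>\<theta>. rcis r \<theta>) has_vector_derivative \<i> * rcis r \<theta>) (at \<theta>)"
proof -
  have "((\<lambda>\<theta>. of_real r * exp (\<i> * of_real \<theta>)) has_vector_derivative
      of_real r * (\<i> * exp (\<i> * of_real \<theta>))) (at \<theta>)"
    by (auto intro!: derivative_eq_intros has_vector_derivative_real_field)
  then show ?thesis
    by (simp add: rcis_def cis_conv_exp mult_ac)
qed

lemma harmonic_circle_derivative:
  assumes "(H has_field_derivative H') (at (rcis r \<theta>))"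
    and "(G has_field_derivative G') (at (rcis r \<theta>))"
  shows "((\<lambda>\<theta>. H (rcis r \<theta>) + cnj (G (rcis r \<theta>))) has_vector_derivative
           \<i> * (rcis r \<theta> * H' - cnj (rcis r \<theta> * G'))) (at \<theta>)"
proof -
  have "((\<lambda>\<theta>. H (rcis r \<theta>)) has_vector_derivative \<i> * rcis r \<theta> * H') (at \<theta>)"
    "((\<lambda>\<theta>. G (rcis r \<theta>)) has_vector_derivative \<i> * rcis r \<theta> * G') (at \<theta>)"
    using field_vector_diff_chain_at[OF rcis_has_vector_derivative] assms
    by (auto simp: o_def)
  then have "((\<lambda>\<theta>. H (rcis r \<theta>) + cnj (G (rcis r \<theta>))) has_vector_derivative
      \<i> * rcis r \<theta> * H' + cnj (\<i> * rcis r \<theta> * G')) (at \<theta>)"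
    by (intro has_vector_derivative_add bounded_linear.has_vector_derivative[OF bounded_linear_cnj])
  then show ?thesis by (simp add: algebra_simps)
qed

text \<open>Rotating \<open>F t\<close> back by \<open>\<phi> t\<close> gives the real number \<open>|F t|\<close>, so the derivative of the rotated curve
  has imaginary part zero. This determines the derivative of every branch of the argument.\<close>

lemma arg_branch_derivative:
  assumes F: "(F has_vector_derivative F') (at \<theta>)" and "F \<theta> \<noteq> 0"
    and \<phi>: "(\<phi> has_real_derivative D) (at \<theta>)"
    and eq: "\<And>t. F t = rcis (cmod (F t)) (\<phi> t)"
  shows "D = Im (F' / F \<theta>)"
proof -
  have e: "((\<lambda>t. cis (- \<phi> t)) has_vector_derivative (- D) *\<^sub>R (\<i> * cis (- \<phi> \<theta>))) (at \<theta>)"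
  proof -
    have "((\<lambda>t. - \<phi> t) has_vector_derivative - D) (at \<theta>)"
      using \<phi> by (auto intro!: derivative_eq_intros simp flip: has_real_derivative_iff_has_vector_derivative)
    from vector_diff_chain_at[OF this, of cis] rcis_has_vector_derivative[of 1]
    show ?thesis by (simp add: o_def rcis_def)
  qed
  have "((\<lambda>t. Im (F t * cis (- \<phi> t))) has_vector_derivative
      Im (F \<theta> * ((- D) *\<^sub>R (\<i> * cis (- \<phi> \<theta>))) + F' * cis (- \<phi> \<theta>))) (at \<theta>)"
    by (intro bounded_linear.has_vector_derivative[OF bounded_linear_Im]
        has_vector_derivative_mult F e)
  moreover have rot: "F t * cis (- \<phi> t) = of_real (cmod (F t))" for t
    by (subst eq) (simp add: rcis_def cis_mult mult.assoc)
  ultimately have "((\<lambda>t. 0) has_vector_derivative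
      Im (F \<theta> * ((- D) *\<^sub>R (\<i> * cis (- \<phi> \<theta>))) + F' * cis (- \<phi> \<theta>))) (at \<theta>)"
    by simp
  then have "Im (F \<theta> * ((- D) *\<^sub>R (\<i> * cis (- \<phi> \<theta>))) + F' * cis (- \<phi> \<theta>)) = 0"
    using has_vector_derivative_const vector_derivative_unique_at by blast
  also have "F \<theta> * ((- D) *\<^sub>R (\<i> * cis (- \<phi> \<theta>))) + F' * cis (- \<phi> \<theta>)
      = of_real (cmod (F \<theta>)) * (F' / F \<theta> - \<i> * of_real D)"
    using rot[of \<theta>] \<open>F \<theta> \<noteq> 0\<close>
    by (simp add: scaleR_conv_of_real field_simps)
  finally show ?thesis using \<open>F \<theta> \<noteq> 0\<close> by simp
qed

text \<open>A curve that stays closer to the circle point \<open>rcis r \<theta>\<close> than the origin does can be written as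
  \<open>q \<theta> * rcis r \<theta>\<close> with \<open>q\<close> in the right half-plane. Hence \<open>\<theta> + Im (Ln (q \<theta>))\<close> is a smooth branch of
  its argument along the whole circle: the principal logarithm never meets its cut.\<close>

lemma arg_branch_exists:
  fixes F F' :: "real \<Rightarrow> complex"
  assumes "0 < r"
    and F: "\<And>\<theta>. (F has_vector_derivative F' \<theta>) (at \<theta>)"
    and near: "\<And>\<theta>. cmod (F \<theta> - rcis r \<theta>) < r"
  obtains \<phi> :: "real \<Rightarrow> real"
  where "\<And>\<theta>. F \<theta> \<noteq> 0" "\<And>\<theta>. F \<theta> = rcis (cmod (F \<theta>)) (\<phi> \<theta>)"
    and "\<And>\<theta>. (\<phi> has_real_derivative Im (F' \<theta> / F \<theta>)) (at \<theta>)"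
proof
  define q where "q \<theta> = F \<theta> * rcis (1 / r) (- \<theta>)" for \<theta>
  define \<phi> where "\<phi> \<theta> = \<theta> + Im (Ln (q \<theta>))" for \<theta>
  have qF: "F \<theta> = q \<theta> * rcis r \<theta>" for \<theta>
    using \<open>0 < r\<close> by (simp add: q_def rcis_mult mult.assoc)
  have q_pos: "0 < Re (q \<theta>)" for \<theta>
  proof -
    have "F \<theta> - rcis r \<theta> = (q \<theta> - 1) * rcis r \<theta>"
      by (subst qF) (simp add: algebra_simps)
    then have "cmod (q \<theta> - 1) * r < 1 * r"
      using near[of \<theta>] \<open>0 < r\<close> by (simp add: norm_mult)
    then have "cmod (q \<theta> - 1) < 1"
      using \<open>0 < r\<close> by simp
    then show ?thesis
      using abs_Re_le_cmod[of "q \<theta> - 1"] by simp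
  qed
  then have q0: "q \<theta> \<noteq> 0" for \<theta> by (metis less_irrefl zero_complex.sel(1))
  show F0: "F \<theta> \<noteq> 0" for \<theta>
    using q0 \<open>0 < r\<close> by (simp add: qF)
  show "F \<theta> = rcis (cmod (F \<theta>)) (\<phi> \<theta>)" for \<theta>
  proof -
    have "q \<theta> = rcis (cmod (q \<theta>)) (Im (Ln (q \<theta>)))"
      using q0 by (simp add: Arg_eq_Im_Ln[symmetric] rcis_cmod_Arg)
    then have "F \<theta> = rcis (cmod (q \<theta>)) (Im (Ln (q \<theta>))) * rcis r \<theta>"
      using qF by metis
    moreover have "cmod (F \<theta>) = cmod (q \<theta>) * r"
      using \<open>0 < r\<close> by (simp add: qF norm_mult)
    ultimately show ?thesis
      by (simp add: rcis_mult \<phi>_def add.commute)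
  qed
  show "(\<phi> has_real_derivative Im (F' \<theta> / F \<theta>)) (at \<theta>)" for \<theta>
  proof -
    have "((\<lambda>t. - t) has_vector_derivative - 1) (at \<theta>)"
      by (auto intro!: derivative_eq_intros)
    from vector_diff_chain_at[OF this, of "rcis (1 / r)"] rcis_has_vector_derivative[of "1 / r"]
    have "((\<lambda>t. rcis (1 / r) (- t)) has_vector_derivative - (\<i> * rcis (1 / r) (- \<theta>))) (at \<theta>)"
      by (simp add: o_def)
    from has_vector_derivative_mult[OF F this]
    have "(q has_vector_derivative F \<theta> * - (\<i> * rcis (1 / r) (- \<theta>)) + F' \<theta> * rcis (1 / r) (- \<theta>))
        (at \<theta>)"
      by (simp add: q_def[abs_def])
    also have "F \<theta> * - (\<i> * rcis (1 / r) (- \<theta>)) + F' \<theta> * rcis (1 / r) (- \<theta>)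
        = q \<theta> * (F' \<theta> / F \<theta> - \<i>)"
      using F0 by (simp add: q_def field_simps)
    finally have dq: "(q has_vector_derivative q \<theta> * (F' \<theta> / F \<theta> - \<i>)) (at \<theta>)" .
    have "q \<theta> \<notin> \<real>\<^sub>\<le>\<^sub>0"
      using q_pos[of \<theta>] by (auto simp: complex_nonpos_Reals_iff)
    then have "(Ln has_field_derivative inverse (q \<theta>)) (at (q \<theta>))"
      by (rule has_field_derivative_Ln)
    from field_vector_diff_chain_at[OF dq this]
    have "((\<lambda>t. Ln (q t)) has_vector_derivative F' \<theta> / F \<theta> - \<i>) (at \<theta>)"
      using q0[of \<theta>] by (simp add: o_def divide_inverse[symmetric])
    from bounded_linear.has_vector_derivative[OF bounded_linear_Im this]
    have "((\<lambda>t. Im (Ln (q t))) has_real_derivative Im (F' \<theta> / F \<theta>) - 1) (at \<theta>)"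
      by (simp add: has_real_derivative_iff_has_vector_derivative)
    from DERIV_add[OF DERIV_ident this] show ?thesis
      by (simp add: \<phi>_def[abs_def])
  qed
qed

section \<open>A coefficient condition for full starlikeness\<close>

text \<open>A complex number \<open>w\<close> has positive real part iff it lies closer to \<open>1\<close> than to \<open>-1\<close>; here
  \<open>w = N / F - \<alpha>\<close>.\<close>

lemma Re_divide_gt_if_norm_less:
  assumes "F \<noteq> 0" and "cmod (N - (1 + of_real \<alpha>) * F) < cmod (N + (1 - of_real \<alpha>) * F)"
  shows "\<alpha> < Re (N / F)"
proof -
  define w where "w = N / F - of_real \<alpha>"
  have "cmod ((w - 1) * F) < cmod ((w + 1) * F)"
    using assms by (simp add: w_def algebra_simps)
  then have "cmod (w - 1) < cmod (w + 1)"
    using assms(1) by (simp add: norm_mult)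
  then have "(cmod (w - 1))\<^sup>2 < (cmod (w + 1))\<^sup>2"
    by (simp add: power_strict_mono)
  then have "(Re w - 1)\<^sup>2 + (Im w)\<^sup>2 < (Re w + 1)\<^sup>2 + (Im w)\<^sup>2"
    by (simp only: cmod_power2 minus_complex.sel plus_complex.sel one_complex.sel diff_0_right add_0_right)
  then have "0 < Re w"
    by (simp add: power2_eq_square algebra_simps)
  then show ?thesis by (simp add: w_def)
qed

text \<open>For \<open>n \<ge> 2\<close> both \<open>n - \<alpha>\<close> and \<open>n + \<alpha>\<close> are at least \<open>n (1 - \<alpha>)\<close>, so the hypothesis implies
  \<open>\<Sum>n\<ge>2. n (|A_n| + |B_n|) \<le> 1\<close>. This makes \<open>F - z\<close> and its derivatives small enough for
  univalence, the sense-preserving property and \<open>|F z - z| < |z|\<close>. The sharper weights \<open>n - \<alpha>\<close> and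
  \<open>n + \<alpha>\<close> themselves come from the series of \<open>N - \<alpha> F\<close> and control the derivative of the argument.\<close>

theorem fully_starlike_if_coefficient_sum:
  fixes A B :: "nat \<Rightarrow> complex" and \<alpha> :: real
  defines "w \<equiv> \<lambda>n. (real n - \<alpha>) * cmod (A n) + (real n + \<alpha>) * cmod (B n)"
  assumes \<alpha>: "0 \<le> \<alpha>" "\<alpha> < 1"
    and H: "\<And>z. z \<in> ball 0 1 \<Longrightarrow> (\<lambda>n. A n * z ^ n) sums H z"
    and G: "\<And>z. z \<in> ball 0 1 \<Longrightarrow> (\<lambda>n. B n * z ^ n) sums G z"
    and F: "\<And>z. z \<in> ball 0 1 \<Longrightarrow> F z = H z + cnj (G z)"
    and AB: "A 0 = 0" "A 1 = 1" "B 0 = 0" "B 1 = 0"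
    and w: "summable (\<lambda>n. w (n + 2))" "(\<Sum>n. w (n + 2)) \<le> 1 - \<alpha>"
  shows "fully_starlike \<alpha> F"
proof -
  have hol: "H holomorphic_on ball 0 1" "G holomorphic_on ball 0 1"
    using power_series_holomorphic[of 0 1 A H] power_series_holomorphic[of 0 1 B G] H G by simp_all
  then have dH: "(H has_field_derivative deriv H z) (at z)"
    and dG: "(G has_field_derivative deriv G z) (at z)" if "z \<in> ball 0 1" for z
    using that by (auto intro: holomorphic_derivI)
  have zH: "(\<lambda>n. of_nat n * A n * z ^ n) sums (z * deriv H z)"
    and zG: "(\<lambda>n. of_nat n * B n * z ^ n) sums (z * deriv G z)" if "z \<in> ball 0 1" for z
    using sums_z_times_deriv[where K = 1, OF _ dH] sums_z_times_deriv[where K = 1, OF _ dG] H G that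
    by simp_all
  have H0: "H 0 = 0" and G0: "G 0 = 0"
    using sums_unique2[OF H[of 0] powser_sums_zero] sums_unique2[OF G[of 0] powser_sums_zero] AB
    by simp_all
  have dH0: "deriv H 0 = 1" and dG0: "deriv G 0 = 0"
  proof -
    have "(\<lambda>n. diffs A n * 0 ^ n) sums deriv H 0" "(\<lambda>n. diffs B n * 0 ^ n) sums deriv G 0"
      using termdiffs_sums_strong[of 1 A H _ 0] termdiffs_sums_strong[of 1 B G _ 0] dH dG H G
      by auto
    then show "deriv H 0 = 1" "deriv G 0 = 0"
      using sums_unique2[OF _ powser_sums_zero] AB by (fastforce simp: diffs_def)+
  qed
  have nw: "real n * (cmod (A n) + cmod (B n)) \<le> w n / (1 - \<alpha>)" if "n \<ge> 2" for n
  proof -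
    have "\<alpha> \<le> real n * \<alpha>" using that \<alpha> by (simp add: mult_le_cancel_right1)
    then have "real n * (1 - \<alpha>) \<le> real n - \<alpha>" "real n * (1 - \<alpha>) \<le> real n + \<alpha>"
      using \<alpha> by (simp_all add: algebra_simps)
    then have "real n * (1 - \<alpha>) * cmod (A n) + real n * (1 - \<alpha>) * cmod (B n) \<le> w n"
      unfolding w_def by (intro add_mono mult_right_mono) auto
    then have "real n * (cmod (A n) + cmod (B n)) * (1 - \<alpha>) \<le> w n"
      by (simp add: algebra_simps)
    then show ?thesis using \<alpha> by (simp add: pos_le_divide_eq)
  qed
  have sum_w': "summable (\<lambda>n. w (n + 2) / (1 - \<alpha>))"
    and sum_w'_le: "(\<Sum>n. w (n + 2) / (1 - \<alpha>)) \<le> 1"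
    using w \<alpha> by (auto simp: suminf_divide intro: summable_divide)
  have pow_le: "cmod z ^ n \<le> (cmod z)\<^sup>2" if "z \<in> ball 0 1" "n \<ge> 2" for z :: complex and n
    using that by (intro power_decreasing) auto
  have sq_less: "(cmod z)\<^sup>2 < cmod z" if "z \<in> ball 0 1" "z \<noteq> 0" for z :: complex
    using that by (simp add: power2_eq_square)

  \<comment> \<open>\<open>F x = F y\<close> would make the nonlinear part of \<open>F x - F y\<close> as large as \<open>x - y\<close>. For strictness one
    stays in a disc of radius \<open>r < 1\<close>, where \<open>|x^n - y^n| \<le> n r |x - y|\<close> for \<open>n \<ge> 2\<close>.\<close>
  have inj: "inj_on F (ball 0 1)"
  proof (rule inj_onI, rule ccontr)
    fix x y :: complex
    assume xy: "x \<in> ball 0 1" "y \<in> ball 0 1" "F x = F y" "x \<noteq> y"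
    define r where "r = max (cmod x) (cmod y)"
    have r: "0 \<le> r" "r < 1" "cmod x \<le> r" "cmod y \<le> r"
      using xy by (auto simp: r_def le_max_iff_disj)
    have "cmod ((H x - H y) + cnj (G x - G y) - A 1 * (x ^ 1 - y ^ 1))
        \<le> (r * cmod (x - y)) * (\<Sum>n. w (n + 2) / (1 - \<alpha>))"
    proof (rule harmonic_remainder)
      show "(\<lambda>n. A n * (x ^ n - y ^ n)) sums (H x - H y)" "(\<lambda>n. B n * (x ^ n - y ^ n)) sums (G x - G y)"
        using H G xy by (auto simp: right_diff_distrib intro!: sums_diff)
      fix n :: nat assume n: "n \<ge> 2"
      then obtain k where k: "n = Suc (Suc k)" by (metis add_2_eq_Suc le_Suc_ex)
      have "r ^ Suc k \<le> r" using r power_decreasing[of 1 "Suc k" r] by simp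
      have "cmod (x ^ n - y ^ n) \<le> real n * r ^ Suc k * cmod (x - y)"
        using norm_power_diff_le[OF r(3,4), of "Suc k"] k by simp
      also have "\<dots> \<le> real n * r * cmod (x - y)"
        using \<open>r ^ Suc k \<le> r\<close> by (intro mult_right_mono mult_left_mono) auto
      finally have "(cmod (A n) + cmod (B n)) * cmod (x ^ n - y ^ n)
          \<le> (cmod (A n) + cmod (B n)) * (real n * r * cmod (x - y))"
        by (intro mult_left_mono) auto
      also have "\<dots> = r * cmod (x - y) * (real n * (cmod (A n) + cmod (B n)))"
        by (simp add: mult_ac)
      also have "\<dots> \<le> r * cmod (x - y) * (w n / (1 - \<alpha>))"
        using nw[OF n] r by (intro mult_left_mono) auto
      finally show "(cmod (A n) + cmod (B n)) * cmod (x ^ n - y ^ n)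
          \<le> r * cmod (x - y) * (w n / (1 - \<alpha>))" .
    qed (use AB sum_w' in auto)
    also have "\<dots> \<le> r * cmod (x - y) * 1"
      using sum_w'_le r by (intro mult_left_mono) auto
    also have "\<dots> < cmod (x - y)"
      using r xy by simp
    also have "(H x - H y) + cnj (G x - G y) - A 1 * (x ^ 1 - y ^ 1) = - (x - y)"
      using F[of x] F[of y] xy AB by (simp add: algebra_simps)
    finally show False by (simp only: norm_minus_cancel less_irrefl)
  qed

  have sense: "cmod (deriv G z) < cmod (deriv H z)" if z: "z \<in> ball 0 1" for z
  proof (cases "z = 0")
    case False
    let ?S = "\<lambda>C. (\<Sum>n. real (n + 2) * cmod (C (n + 2)))"
    have sumA: "summable (\<lambda>n. real (n + 2) * cmod (A (n + 2)))"
      and sumB: "summable (\<lambda>n. real (n + 2) * cmod (B (n + 2)))"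
    proof -
      have "norm (real n * cmod (A n)) \<le> w n / (1 - \<alpha>)" "norm (real n * cmod (B n)) \<le> w n / (1 - \<alpha>)"
        if "n \<ge> 2" for n
      proof -
        have "0 \<le> real n * cmod (A n)" "0 \<le> real n * cmod (B n)" by simp_all
        then show "norm (real n * cmod (A n)) \<le> w n / (1 - \<alpha>)"
          "norm (real n * cmod (B n)) \<le> w n / (1 - \<alpha>)"
          using nw[OF that] unfolding distrib_left real_norm_def by linarith+
      qed
      then show "summable (\<lambda>n. real (n + 2) * cmod (A (n + 2)))"
        "summable (\<lambda>n. real (n + 2) * cmod (B (n + 2)))"
        by (intro summable_comparison_test'[OF sum_w', of 0]; blast intro: le_add2)+
    qed
    have "?S A + ?S B = (\<Sum>n. real (n + 2) * cmod (A (n + 2)) + real (n + 2) * cmod (B (n + 2)))"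
      by (rule suminf_add[OF sumA sumB])
    also have "\<dots> \<le> (\<Sum>n. w (n + 2) / (1 - \<alpha>))"
      by (rule suminf_le[OF _ summable_add[OF sumA sumB] sum_w'])
         (simp only: distrib_left[symmetric] nw le_add2)
    finally have "?S A + ?S B \<le> 1" using sum_w'_le by simp
    have "cmod (z * deriv H z + cnj 0 - of_nat 1 * A 1 * z ^ 1) \<le> (cmod z)\<^sup>2 * ?S A"
      by (rule harmonic_remainder[where q = "\<lambda>_. 0", OF zH[OF z]])
         (use AB sumA pow_le[OF z] in \<open>auto simp: norm_mult norm_power mult_ac intro!: mult_left_mono\<close>)
    moreover have "cmod (z * deriv G z + cnj 0 - of_nat 1 * B 1 * z ^ 1) \<le> (cmod z)\<^sup>2 * ?S B"
      by (rule harmonic_remainder[where q = "\<lambda>_. 0", OF zG[OF z]])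
         (use AB sumB pow_le[OF z] in \<open>auto simp: norm_mult norm_power mult_ac intro!: mult_left_mono\<close>)
    moreover have "(cmod z)\<^sup>2 * (?S A + ?S B) \<le> (cmod z)\<^sup>2 * 1"
      using \<open>?S A + ?S B \<le> 1\<close> by (rule mult_left_mono) simp
    moreover have "cmod z \<le> cmod (z * deriv H z) + cmod (z * deriv H z - z)"
      by norm
    ultimately have "cmod (z * deriv G z) < cmod (z * deriv H z)"
      using sq_less[OF z False] AB by (simp add: distrib_left)
    then show ?thesis by (simp add: norm_mult mult_less_cancel_left)
  qed (simp add: dH0 dG0)

  have near: "cmod (F z - z) < cmod z" if z: "z \<in> ball 0 1" "z \<noteq> 0" for z
  proof -
    have "cmod (H z + cnj (G z) - A 1 * z ^ 1) \<le> (cmod z)\<^sup>2 * (\<Sum>n. w (n + 2) / (1 - \<alpha>))"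
    proof (rule harmonic_remainder[OF H G])
      fix n :: nat assume n: "n \<ge> 2"
      have "cmod (A n) + cmod (B n) \<le> real n * (cmod (A n) + cmod (B n))"
        using n mult_right_mono[of 1 "real n" "cmod (A n) + cmod (B n)"] by simp
      then have "cmod (A n) + cmod (B n) \<le> w n / (1 - \<alpha>)"
        using nw[OF n] by linarith
      then have "cmod z ^ n * (cmod (A n) + cmod (B n)) \<le> (cmod z)\<^sup>2 * (w n / (1 - \<alpha>))"
        using pow_le[OF z(1) n] by (intro mult_mono) auto
      then show "(cmod (A n) + cmod (B n)) * cmod (z ^ n) \<le> (cmod z)\<^sup>2 * (w n / (1 - \<alpha>))"
        by (simp add: norm_power mult.commute)
    qed (use z AB sum_w' in auto)
    also have "\<dots> \<le> (cmod z)\<^sup>2 * 1"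
      using sum_w'_le by (intro mult_left_mono) auto
    also have "\<dots> < cmod z" using sq_less[OF z] by simp
    finally show ?thesis using F z AB by simp
  qed

  have star: "\<alpha> < Re ((z * deriv H z - cnj (z * deriv G z)) / F z)"
    if z: "z \<in> ball 0 1" "z \<noteq> 0" for z
  proof (rule Re_divide_gt_if_norm_less)
    let ?N = "z * deriv H z - cnj (z * deriv G z)"
    show "F z \<noteq> 0" using near[OF z] by auto
    \<comment> \<open>\<open>m1\<close> and \<open>m2\<close> are the coefficient sizes of \<open>N + (1 - \<alpha>) F\<close> and \<open>N - (1 + \<alpha>) F\<close>, whose linear
      terms are \<open>(2 - \<alpha>) z\<close> and \<open>- \<alpha> z\<close>. The moduli of these terms differ by \<open>2 (1 - \<alpha>) |z|\<close>, while
      \<open>m1 + m2 = 2 w\<close>.\<close>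
    define m1 m2 where "m1 n = (real n + 1 - \<alpha>) * cmod (A n) + (real n - 1 + \<alpha>) * cmod (B n)"
      and "m2 n = (real n - 1 - \<alpha>) * cmod (A n) + (real n + 1 + \<alpha>) * cmod (B n)" for n
    have m12: "m1 n + m2 n = 2 * w n" for n
      by (simp add: m1_def m2_def w_def algebra_simps)
    have m_nonneg: "0 \<le> m1 n" "0 \<le> m2 n" if "n \<ge> 2" for n
      using that \<alpha> by (auto simp: m1_def m2_def)
    have sum_m: "summable (\<lambda>n. m1 (n + 2))" "summable (\<lambda>n. m2 (n + 2))"
    proof -
      have "norm (m1 n) \<le> 2 * w n" "norm (m2 n) \<le> 2 * w n" if "n \<ge> 2" for n
        using m12[of n] m_nonneg[OF that] by auto
      then show "summable (\<lambda>n. m1 (n + 2))" "summable (\<lambda>n. m2 (n + 2))"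
        by (intro summable_comparison_test'[OF summable_mult[OF w(1), of 2], of 0]; blast intro: le_add2)+
    qed
    have "(\<Sum>n. m1 (n + 2)) + (\<Sum>n. m2 (n + 2)) = 2 * (\<Sum>n. w (n + 2))"
      using sum_m w(1) by (simp add: suminf_add m12 suminf_mult)
    then have m_le: "(\<Sum>n. m1 (n + 2)) + (\<Sum>n. m2 (n + 2)) \<le> 2 * (1 - \<alpha>)"
      using w(2) by simp
    have zn: "M * cmod (z ^ n) \<le> (cmod z)\<^sup>2 * M" if "n \<ge> 2" "0 \<le> M" for M n
      using pow_le[OF z(1) that(1)] that(2) by (simp add: norm_power mult.commute mult_left_mono)
    have "cmod ((z * deriv H z + (1 - of_real \<alpha>) * H z)
          + cnj ((1 - of_real \<alpha>) * G z - z * deriv G z)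
          - (of_nat 1 * A 1 + (1 - of_real \<alpha>) * A 1) * z ^ 1)
        \<le> (cmod z)\<^sup>2 * (\<Sum>n. m1 (n + 2))"
    proof (rule harmonic_remainder)
      show "(\<lambda>n. (of_nat n * A n + (1 - of_real \<alpha>) * A n) * z ^ n)
          sums (z * deriv H z + (1 - of_real \<alpha>) * H z)"
        using sums_add[OF zH[OF z(1)] sums_mult[OF H[OF z(1)], of "1 - of_real \<alpha>"]]
        by (simp add: algebra_simps)
      show "(\<lambda>n. ((1 - of_real \<alpha>) * B n - of_nat n * B n) * z ^ n)
          sums ((1 - of_real \<alpha>) * G z - z * deriv G z)"
        using sums_diff[OF sums_mult[OF G[OF z(1)], of "1 - of_real \<alpha>"] zG[OF z(1)]]
        by (simp add: algebra_simps)
      fix n :: nat assume n: "n \<ge> 2"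
      have "of_nat n * A n + (1 - of_real \<alpha>) * A n = of_real (real n + 1 - \<alpha>) * A n"
        "(1 - of_real \<alpha>) * B n - of_nat n * B n = - of_real (real n - 1 + \<alpha>) * B n"
        by (simp_all add: algebra_simps)
      then have "cmod (of_nat n * A n + (1 - of_real \<alpha>) * A n)
          + cmod ((1 - of_real \<alpha>) * B n - of_nat n * B n) = m1 n"
        using n \<alpha> by (simp only: norm_mult norm_minus_cancel norm_of_real m1_def)
      then show "(cmod (of_nat n * A n + (1 - of_real \<alpha>) * A n)
          + cmod ((1 - of_real \<alpha>) * B n - of_nat n * B n)) * cmod (z ^ n) \<le> (cmod z)\<^sup>2 * m1 n"
        using zn[OF n] m_nonneg(1)[OF n] by simp
    qed (use AB sum_m in auto)
    then have 1: "cmod (?N + (1 - of_real \<alpha>) * F z - of_real (2 - \<alpha>) * z)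
        \<le> (cmod z)\<^sup>2 * (\<Sum>n. m1 (n + 2))"
      using F z AB by (simp add: algebra_simps)
    have "cmod ((z * deriv H z - (1 + of_real \<alpha>) * H z)
          + cnj (- (1 + of_real \<alpha>) * G z - z * deriv G z)
          - (of_nat 1 * A 1 - (1 + of_real \<alpha>) * A 1) * z ^ 1)
        \<le> (cmod z)\<^sup>2 * (\<Sum>n. m2 (n + 2))"
    proof (rule harmonic_remainder)
      show "(\<lambda>n. (of_nat n * A n - (1 + of_real \<alpha>) * A n) * z ^ n)
          sums (z * deriv H z - (1 + of_real \<alpha>) * H z)"
        using sums_diff[OF zH[OF z(1)] sums_mult[OF H[OF z(1)], of "1 + of_real \<alpha>"]]
        by (simp add: algebra_simps)
      show "(\<lambda>n. (- (1 + of_real \<alpha>) * B n - of_nat n * B n) * z ^ n)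
          sums (- (1 + of_real \<alpha>) * G z - z * deriv G z)"
        using sums_diff[OF sums_mult[OF G[OF z(1)], of "- (1 + of_real \<alpha>)"] zG[OF z(1)]]
        by (simp add: algebra_simps)
      fix n :: nat assume n: "n \<ge> 2"
      have "of_nat n * A n - (1 + of_real \<alpha>) * A n = of_real (real n - 1 - \<alpha>) * A n"
        "- (1 + of_real \<alpha>) * B n - of_nat n * B n = - of_real (real n + 1 + \<alpha>) * B n"
        by (simp_all add: algebra_simps)
      then have "cmod (of_nat n * A n - (1 + of_real \<alpha>) * A n)
          + cmod (- (1 + of_real \<alpha>) * B n - of_nat n * B n) = m2 n"
        using n \<alpha> by (simp only: norm_mult norm_minus_cancel norm_of_real m2_def)
      then show "(cmod (of_nat n * A n - (1 + of_real \<alpha>) * A n)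
          + cmod (- (1 + of_real \<alpha>) * B n - of_nat n * B n)) * cmod (z ^ n) \<le> (cmod z)\<^sup>2 * m2 n"
        using zn[OF n] m_nonneg(2)[OF n] by simp
    qed (use AB sum_m in auto)
    then have 2: "cmod (?N - (1 + of_real \<alpha>) * F z + of_real \<alpha> * z)
        \<le> (cmod z)\<^sup>2 * (\<Sum>n. m2 (n + 2))"
      using F z AB by (simp add: algebra_simps)
    have "(cmod z)\<^sup>2 * ((\<Sum>n. m1 (n + 2)) + (\<Sum>n. m2 (n + 2))) \<le> (cmod z)\<^sup>2 * (2 * (1 - \<alpha>))"
      using m_le by (intro mult_left_mono) auto
    also have "\<dots> < cmod z * (2 * (1 - \<alpha>))"
      using sq_less[OF z] \<alpha> by (intro mult_strict_right_mono) auto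
    finally have "(cmod z)\<^sup>2 * (\<Sum>n. m1 (n + 2)) + (cmod z)\<^sup>2 * (\<Sum>n. m2 (n + 2))
        < (2 - \<alpha>) * cmod z - \<alpha> * cmod z"
      by (simp add: algebra_simps)
    moreover have "cmod (of_real (2 - \<alpha>) * z) = (2 - \<alpha>) * cmod z" "cmod (of_real \<alpha> * z) = \<alpha> * cmod z"
      using \<alpha> by (simp_all only: norm_mult norm_of_real)
    moreover have "cmod (of_real (2 - \<alpha>) * z) \<le> cmod (?N + (1 - of_real \<alpha>) * F z)
        + cmod (?N + (1 - of_real \<alpha>) * F z - of_real (2 - \<alpha>) * z)"
      by norm
    moreover have "cmod (?N - (1 + of_real \<alpha>) * F z)
        \<le> cmod (?N - (1 + of_real \<alpha>) * F z + of_real \<alpha> * z) + cmod (of_real \<alpha> * z)"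
      by norm
    ultimately show "cmod (?N - (1 + of_real \<alpha>) * F z) < cmod (?N + (1 - of_real \<alpha>) * F z)"
      using 1 2 by linarith
  qed

  show ?thesis
    unfolding fully_starlike_def
  proof (intro conjI ballI)
    show "F \<in> class_SH"
      using inj sense hol H0 G0 dH0 F
      unfolding class_SH_def normalized_harmonic_def by blast
    fix r :: real assume r: "r \<in> {0<..<1}"
    then have z: "rcis r \<theta> \<in> ball 0 1" "rcis r \<theta> \<noteq> 0" for \<theta> by auto
    show "inj_on F (sphere 0 r)"
      using inj r by (auto intro: inj_on_subset)
    let ?F' = "\<lambda>\<theta>. \<i> * (rcis r \<theta> * deriv H (rcis r \<theta>) - cnj (rcis r \<theta> * deriv G (rcis r \<theta>)))"
    have "((\<lambda>\<theta>. F (rcis r \<theta>)) has_vector_derivative ?F' \<theta>) (at \<theta>)" for \<theta>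
      using harmonic_circle_derivative[OF dH[OF z(1)] dG[OF z(1)]] F[OF z(1)] by simp
    moreover have "cmod (F (rcis r \<theta>) - rcis r \<theta>) < r" for \<theta>
      using near[OF z] r by simp
    ultimately obtain \<phi> :: "real \<Rightarrow> real" where \<phi>: "\<And>\<theta>. F (rcis r \<theta>) \<noteq> 0"
      "\<And>\<theta>. F (rcis r \<theta>) = rcis (cmod (F (rcis r \<theta>))) (\<phi> \<theta>)"
      "\<And>\<theta>. (\<phi> has_real_derivative Im (?F' \<theta> / F (rcis r \<theta>))) (at \<theta>)"
      using arg_branch_exists[of r "\<lambda>\<theta>. F (rcis r \<theta>)" ?F'] r by auto
    have "\<alpha> < Im (?F' \<theta> / F (rcis r \<theta>))" for \<theta>
      using star[OF z, of \<theta>] by (simp only: times_divide_eq_right[symmetric] Im_i_times)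
    moreover have "continuous_on UNIV \<phi>"
      using \<phi>(3) by (meson DERIV_isCont continuous_at_imp_continuous_on)
    ultimately show "\<exists>\<phi>::real \<Rightarrow> real. continuous_on UNIV \<phi> \<and>
        (\<forall>\<theta>. F (rcis r \<theta>) \<noteq> 0 \<and> F (rcis r \<theta>) = rcis (cmod (F (rcis r \<theta>))) (\<phi> \<theta>)) \<and>
        (\<forall>\<theta>\<in>{0..<2*pi}. \<exists>D. (\<phi> has_real_derivative D) (at \<theta>) \<and> D > \<alpha>)"
      using \<phi> by blast
  qed
qed


section \<open>The polynomial\<close>

text \<open>Writing \<open>s_poly \<alpha> t = (1 - \<alpha>) p(t) - 6 t\<close> with \<open>p = 1 - 6 t + 11 t\<^sup>2 - 8 t\<^sup>3 + 2 t\<^sup>4\<close>, it suffices that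
  \<open>p' < 6\<close> on \<open>[0, 1]\<close>.\<close>

lemma s_poly_strict_antimono:
  assumes \<alpha>: "0 \<le> \<alpha>" "\<alpha> < 1" and xy: "0 \<le> x" "x < y" "y \<le> 1"
  shows "s_poly \<alpha> y < s_poly \<alpha> x"
proof (rule DERIV_neg_imp_decreasing[OF xy(2)])
  fix t assume t: "x \<le> t" "t \<le> y"
  define p' where "p' = - 6 + 22 * t - 24 * t^2 + 8 * t^3"
  have "(s_poly \<alpha> has_real_derivative (1 - \<alpha>) * p' - 6) (at t)"
    unfolding s_poly_def[abs_def] p'_def
    by (auto intro!: derivative_eq_intros simp: algebra_simps)
  moreover have "(1 - \<alpha>) * p' < 6"
  proof (cases "p' \<le> 0")
    case True
    then have "(1 - \<alpha>) * p' \<le> 0"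
      using \<alpha> by (simp add: mult_le_0_iff)
    then show ?thesis by simp
  next
    case False
    have "p' = 6 - 8 * (t\<^sup>2 * (1 - t)) - (4 * t - 11 / 4)\<^sup>2 - 71 / 16"
      by (simp add: p'_def power2_eq_square power3_eq_cube algebra_simps)
    moreover have "0 \<le> t\<^sup>2 * (1 - t)" using t xy by simp
    moreover have "0 \<le> (4 * t - 11 / 4)\<^sup>2" by simp
    ultimately have "p' < 6" by linarith
    moreover have "(1 - \<alpha>) * p' \<le> 1 * p'"
      using False \<alpha> by (intro mult_right_mono) auto
    ultimately show ?thesis by simp
  qed
  ultimately show "\<exists>D. (s_poly \<alpha> has_real_derivative D) (at t) \<and> D < 0"
    by force
qed

lemma s_poly_root_ex1:
  assumes \<alpha>: "0 \<le> \<alpha>" "\<alpha> < 1"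
  shows "\<exists>!r. r \<in> {0<..<1} \<and> s_poly \<alpha> r = 0"
proof (rule ex_ex1I)
  have "continuous_on {0..1} (s_poly \<alpha>)"
    unfolding s_poly_def[abs_def] by (intro continuous_intros)
  moreover have ends: "s_poly \<alpha> 1 < 0" "0 < s_poly \<alpha> 0"
    using \<alpha> by (simp_all add: s_poly_def)
  ultimately obtain r where "0 \<le> r" "r \<le> 1" "s_poly \<alpha> r = 0"
    using IVT2'[of "s_poly \<alpha>" 1 0 0] by auto
  then show "\<exists>r. r \<in> {0<..<1} \<and> s_poly \<alpha> r = 0"
    using ends by (metis greaterThanLessThan_iff less_irrefl order_le_less)
next
  fix r t assume "r \<in> {0<..<1} \<and> s_poly \<alpha> r = 0" "t \<in> {0<..<1} \<and> s_poly \<alpha> t = 0"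
  then show "r = t"
    using s_poly_strict_antimono[OF \<alpha>, of r t] s_poly_strict_antimono[OF \<alpha>, of t r]
    by (cases r t rule: linorder_cases) auto
qed

text \<open>In the sharpness argument the extremal image \<open>2 x - x / (1 - x)\<^sup>2\<close> must be positive just beyond the
  root. It is so up to \<open>1 - 1 / sqrt 2\<close>, which leaves ample room.\<close>

lemma s_poly_root_less_tenth:
  assumes \<alpha>: "0 \<le> \<alpha>" "\<alpha> < 1" and r: "r \<in> {0<..<1}" "s_poly \<alpha> r = 0"
  shows "r < 1 / 10"
proof (rule ccontr)
  assume "\<not> r < 1 / 10"
  then have "1 / 10 = r \<or> 1 / 10 < r" by linarith
  then have "s_poly \<alpha> r \<le> s_poly \<alpha> (1 / 10)"
    using s_poly_strict_antimono[OF \<alpha>, of "1 / 10" r] r by (elim disjE) (simp only: order_refl, simp)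
  also have "\<dots> < 0"
    using \<alpha> by (simp add: s_poly_def power_numeral_reduce field_simps)
  finally show False using r by simp
qed

text \<open>The terms are the weights \<open>(n - \<alpha>)|A_n| + (n + \<alpha>)|B_n|\<close> when \<open>|a_n|\<close> and \<open>|b_n|\<close> are as large as
  allowed. The first nonzero term, at \<open>n = 1\<close>, equals \<open>1 - \<alpha>\<close>; hence the terms from \<open>n = 2\<close> on sum to
  at most \<open>1 - \<alpha>\<close> exactly when \<open>0 \<le> s_poly \<alpha> r\<close>.\<close>

lemma extremal_weight_sums:
  assumes "0 < r" "r < 1"
  shows "(\<lambda>n. real n * (real n ^ 2 - \<alpha>) * r ^ n / r) sums
           (2 * (1 - \<alpha>) - s_poly \<alpha> r / (1 - r) ^ 4)"
proof -
  have "\<bar>r\<bar> < 1" using assms by simp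
  note s = sums_n_cubed_and_n[OF this]
  have "(\<lambda>n. (real n ^ 3 * r ^ n - \<alpha> * (real n * r ^ n)) / r) sums
      ((r * (1 + 4 * r + r\<^sup>2) / (1 - r) ^ 4 - \<alpha> * (r / (1 - r) ^ 2)) / r)"
    using s by (intro sums_divide sums_diff sums_mult)
  moreover have "(r * (1 + 4 * r + r\<^sup>2) / (1 - r) ^ 4 - \<alpha> * (r / (1 - r) ^ 2)) / r
      = 2 * (1 - \<alpha>) - s_poly \<alpha> r / (1 - r) ^ 4"
  proof -
    have "1 - r \<noteq> 0" using assms by simp
    then have "r * (1 + 4 * r + r\<^sup>2) / (1 - r) ^ 4 - \<alpha> * (r / (1 - r) ^ 2)
        = r * (1 + 4 * r + r\<^sup>2 - \<alpha> * (1 - r)\<^sup>2) / (1 - r) ^ 4"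
      by (simp add: divide_simps) (simp add: power_numeral_reduce algebra_simps)
    moreover have "1 + 4 * r + r\<^sup>2 - \<alpha> * (1 - r)\<^sup>2 = 2 * (1 - \<alpha>) * (1 - r) ^ 4 - s_poly \<alpha> r"
      by (simp add: s_poly_def power_numeral_reduce algebra_simps)
    ultimately show ?thesis
      using assms \<open>1 - r \<noteq> 0\<close> by (simp add: diff_divide_distrib)
  qed
  moreover have "(real n ^ 3 * r ^ n - \<alpha> * (real n * r ^ n)) / r
      = real n * (real n ^ 2 - \<alpha>) * r ^ n / r" for n
    by (simp add: power2_eq_square power3_eq_cube algebra_simps)
  ultimately show ?thesis by (simp only:)
qed

section \<open>The radius works\<close>

lemma fully_starlike_dilation_D_op:
  assumes \<alpha>: "0 \<le> \<alpha>" "\<alpha> < 1" and \<epsilon>: "cmod \<epsilon> = 1"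
    and f: "f \<in> coeff_class" and r: "0 < r" "r < 1" "0 \<le> s_poly \<alpha> r"
  shows "fully_starlike \<alpha> (dilation r (D_op \<epsilon> f))"
proof -
  obtain h g and a b :: "nat \<Rightarrow> complex" where
    hol: "h holomorphic_on ball 0 1" "g holomorphic_on ball 0 1"
    and fhg: "\<And>z. z \<in> ball 0 1 \<Longrightarrow> f z = h z + cnj (g z)"
    and ab: "a 0 = 0" "a 1 = 1" "b 0 = 0" "b 1 = 0"
    and hs: "\<And>z. z \<in> ball 0 1 \<Longrightarrow> (\<lambda>n. a n * z ^ n) sums h z"
    and gs: "\<And>z. z \<in> ball 0 1 \<Longrightarrow> (\<lambda>n. b n * z ^ n) sums g z"
    and bd: "\<And>n. n \<ge> 2 \<Longrightarrow> cmod (a n) \<le> (real n + 1) / 2 \<and> cmod (b n) \<le> (real n - 1) / 2"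
    using f unfolding coeff_class_def by blast
  define A where "A n = of_nat n * a n * of_real (r ^ n / r)" for n
  define B where "B n = - cnj \<epsilon> * (of_nat n * b n * of_real (r ^ n / r))" for n
  define v where "v n = real n * (real n ^ 2 - \<alpha>) * r ^ n / r" for n
  let ?w = "\<lambda>n. (real n - \<alpha>) * cmod (A n) + (real n + \<alpha>) * cmod (B n)"
  have rz: "of_real r * z \<in> ball 0 1" if "z \<in> ball 0 1" for z :: complex
  proof -
    have "r * cmod z \<le> 1 * cmod z" using r by (intro mult_right_mono) auto
    then show ?thesis using that r by (simp add: norm_mult)
  qed
  have v: "(\<lambda>n. v (n + 2)) sums (1 - \<alpha> - s_poly \<alpha> r / (1 - r) ^ 4)"
  proof -
    have vs: "v sums (2 * (1 - \<alpha>) - s_poly \<alpha> r / (1 - r) ^ 4)"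
      unfolding v_def[abs_def] by (rule extremal_weight_sums[OF r(1,2)])
    have "v 0 = 0" "v 1 = 1 - \<alpha>"
      using r by (simp_all add: v_def)
    then have "2 * (1 - \<alpha>) - s_poly \<alpha> r / (1 - r) ^ 4 - sum v {..<2}
        = 1 - \<alpha> - s_poly \<alpha> r / (1 - r) ^ 4"
      by (simp add: numeral_2_eq_2)
    with sums_split_initial_segment[OF vs, of 2] show ?thesis by (simp only:)
  qed
  have w_le: "0 \<le> ?w n \<and> ?w n \<le> v n" if n: "n \<ge> 2" for n
  proof
    show "0 \<le> ?w n" using n \<alpha> by simp
    have nA: "cmod (A n) = real n * cmod (a n) * (r ^ n / r)"
      and nB: "cmod (B n) = real n * cmod (b n) * (r ^ n / r)"
      using r \<epsilon> by (simp_all add: A_def B_def norm_mult norm_divide norm_power)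
    have "?w n = (real n * (r ^ n / r)) * ((real n - \<alpha>) * cmod (a n) + (real n + \<alpha>) * cmod (b n))"
      by (simp add: nA nB algebra_simps add_divide_distrib diff_divide_distrib)
    also have "\<dots> \<le> (real n * (r ^ n / r)) *
        ((real n - \<alpha>) * ((real n + 1) / 2) + (real n + \<alpha>) * ((real n - 1) / 2))"
      using bd[OF n] n \<alpha> r by (intro mult_left_mono add_mono) auto
    also have "(real n - \<alpha>) * ((real n + 1) / 2) + (real n + \<alpha>) * ((real n - 1) / 2)
        = real n ^ 2 - \<alpha>"
      by (simp add: power2_eq_square field_simps)
    also have "real n * (r ^ n / r) * (real n ^ 2 - \<alpha>) = v n"
      by (simp add: v_def mult_ac)
    finally show "?w n \<le> v n" .
  qed
  show ?thesis
  proof (rule fully_starlike_if_coefficient_sum[where A = A and B = B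
        and H = "\<lambda>z. of_real r * z * deriv h (of_real r * z) / of_real r"
        and G = "\<lambda>z. - cnj \<epsilon> * (of_real r * z * deriv g (of_real r * z) / of_real r)"])
    fix z :: complex assume z: "z \<in> ball 0 1"
    have dh: "(h has_field_derivative deriv h (of_real r * z)) (at (of_real r * z))"
      and dg: "(g has_field_derivative deriv g (of_real r * z)) (at (of_real r * z))"
      using hol rz[OF z] by (auto intro: holomorphic_derivI)
    have "(\<lambda>n. of_nat n * a n * (of_real r * z) ^ n / of_real r)
        sums (of_real r * z * deriv h (of_real r * z) / of_real r)"
      using sums_z_times_deriv[where K = 1, OF _ dh] hs rz[OF z] by (intro sums_divide) simp
    then show "(\<lambda>n. A n * z ^ n) sums (of_real r * z * deriv h (of_real r * z) / of_real r)"
      by (simp add: A_def power_mult_distrib mult_ac)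
    have "(\<lambda>n. - cnj \<epsilon> * (of_nat n * b n * (of_real r * z) ^ n / of_real r))
        sums (- cnj \<epsilon> * (of_real r * z * deriv g (of_real r * z) / of_real r))"
      using sums_z_times_deriv[where K = 1, OF _ dg] gs rz[OF z]
      by (intro sums_mult sums_divide) simp
    then show "(\<lambda>n. B n * z ^ n)
        sums (- cnj \<epsilon> * (of_real r * z * deriv g (of_real r * z) / of_real r))"
      by (simp add: B_def power_mult_distrib mult_ac)
    show "dilation r (D_op \<epsilon> f) z = of_real r * z * deriv h (of_real r * z) / of_real r
        + cnj (- cnj \<epsilon> * (of_real r * z * deriv g (of_real r * z) / of_real r))"
      using D_op_harmonic[OF hol fhg rz[OF z]] r by (simp add: dilation_def field_simps)
  next
    have "norm (?w n) \<le> v n" if "n \<ge> 2" for n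
      using w_le[OF that] by simp
    then show "summable (\<lambda>n. ?w (n + 2))"
      by (intro summable_comparison_test'[OF sums_summable[OF v], of 0]) (blast intro: le_add2)
    then have "(\<Sum>n. ?w (n + 2)) \<le> (\<Sum>n. v (n + 2))"
      by (intro suminf_le[OF _ _ sums_summable[OF v]]) (use w_le in \<open>blast intro: le_add2\<close>)
    also have "\<dots> \<le> 1 - \<alpha>"
      using v r by (simp add: sums_iff)
    finally show "(\<Sum>n. ?w (n + 2)) \<le> 1 - \<alpha>" .
  qed (use ab \<alpha> r in \<open>simp_all add: A_def B_def\<close>)
qed

section \<open>The radius is sharp\<close>

text \<open>The series \<open>z - (\<Sum>n\<ge>2. (n + 1) / 2 * z^n)\<close> in closed form.\<close>

definition extremal_h :: "complex \<Rightarrow> complex" where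
  "extremal_h z = 2 * z + 1 / 2 - 1 / (2 * (1 - z) ^ 2)"

text \<open>The series \<open>- \<epsilon> * (\<Sum>n\<ge>2. (n - 1) / 2 * z^n)\<close> in closed form. The factor \<open>- \<epsilon>\<close> cancels the
  \<open>- \<epsilon>\<close> in the operator, so that the extremal image does not depend on \<open>\<epsilon>\<close>.\<close>

definition extremal_g :: "complex \<Rightarrow> complex \<Rightarrow> complex" where
  "extremal_g \<epsilon> z = - \<epsilon> * (z ^ 2 / (2 * (1 - z) ^ 2))"

lemma extremal_derivatives:
  assumes "z \<in> ball 0 1"
  shows "(extremal_h has_field_derivative 2 - 1 / (1 - z) ^ 3) (at z)"
    and "(extremal_g \<epsilon> has_field_derivative - \<epsilon> * (z / (1 - z) ^ 3)) (at z)"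
proof -
  have nz: "1 - z \<noteq> 0" using assms by auto
  then have "((\<lambda>z. 1 / (2 * (1 - z) ^ 2)) has_field_derivative 1 / (1 - z) ^ 3) (at z)"
    by (auto intro!: derivative_eq_intros simp: divide_simps)
       (simp add: power_numeral_reduce algebra_simps)
  moreover have "((\<lambda>z. 2 * z + 1 / 2) has_field_derivative 2) (at z)"
    by (auto intro!: derivative_eq_intros)
  ultimately show "(extremal_h has_field_derivative 2 - 1 / (1 - z) ^ 3) (at z)"
    unfolding extremal_h_def[abs_def] by (intro DERIV_diff)
  have "((\<lambda>z. z ^ 2 / (2 * (1 - z) ^ 2)) has_field_derivative z / (1 - z) ^ 3) (at z)"
    using nz by (auto intro!: derivative_eq_intros simp: divide_simps)
       (simp add: power_numeral_reduce algebra_simps)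
  then show "(extremal_g \<epsilon> has_field_derivative - \<epsilon> * (z / (1 - z) ^ 3)) (at z)"
    unfolding extremal_g_def[abs_def] by (rule DERIV_cmult)
qed

lemma extremal_holomorphic:
  "extremal_h holomorphic_on ball 0 1" "extremal_g \<epsilon> holomorphic_on ball 0 1"
  using extremal_derivatives by (auto simp: holomorphic_on_open) blast+

lemma extremal_in_coeff_class:
  assumes "cmod \<epsilon> = 1"
  shows "(\<lambda>z. extremal_h z + cnj (extremal_g \<epsilon> z)) \<in> coeff_class"
proof -
  \<comment> \<open>The extremal coefficients, arranged as combinations of the series of \<open>1\<close>, \<open>z\<close>, \<open>1 / (1 - z)\<close> and
    \<open>1 / (1 - z)\<^sup>2\<close>.\<close>
  define a :: "nat \<Rightarrow> complex" where
    "a n = (if n = 0 then 1 else 0) / 2 + 2 * (if n = 1 then 1 else 0) - of_nat (Suc n) / 2" for n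
  define b :: "nat \<Rightarrow> complex" where
    "b n = - \<epsilon> * (of_nat (Suc n) / 2 - 1 + (if n = 0 then 1 else 0) / 2)" for n
  have sums: "(\<lambda>n. a n * z ^ n) sums extremal_h z" "(\<lambda>n. b n * z ^ n) sums extremal_g \<epsilon> z"
    if z: "z \<in> ball 0 1" for z
  proof -
    have nz: "1 - z \<noteq> 0" using z by auto
    have e0: "(\<lambda>n. (if n = 0 then 1 else 0) * z ^ n) sums 1"
      and e1: "(\<lambda>n. (if n = 1 then 1 else 0) * z ^ n) sums z"
      using powser_sums_if[of 0 z] powser_sums_if[of 1 z] by (simp_all only: power_0 power_one_right)
    have s1: "(\<lambda>n. z ^ n) sums (1 / (1 - z))"
      and s2: "(\<lambda>n. of_nat (Suc n) * z ^ n) sums (1 / (1 - z) ^ 2)"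
      using z geometric_sums[of z] geometric_deriv_sums[of z] by simp_all
    have "(\<lambda>n. ((if n = 0 then 1 else 0) * z ^ n) / 2 + 2 * ((if n = 1 then 1 else 0) * z ^ n)
        - (of_nat (Suc n) * z ^ n) / 2) sums (1 / 2 + 2 * z - (1 / (1 - z) ^ 2) / 2)"
      by (intro sums_add sums_diff sums_mult sums_divide e0 e1 s2)
    moreover have "1 / 2 + 2 * z - (1 / (1 - z) ^ 2) / 2 = extremal_h z"
      using nz by (simp add: extremal_h_def)
    ultimately show "(\<lambda>n. a n * z ^ n) sums extremal_h z"
      by (simp only: a_def left_diff_distrib distrib_right mult.assoc times_divide_eq_left)
    have "(\<lambda>n. - \<epsilon> * ((of_nat (Suc n) * z ^ n) / 2 - z ^ n + ((if n = 0 then 1 else 0) * z ^ n) / 2))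
        sums (- \<epsilon> * ((1 / (1 - z) ^ 2) / 2 - 1 / (1 - z) + 1 / 2))"
      by (intro sums_add sums_diff sums_mult sums_divide e0 s1 s2)
    moreover have "(1 / (1 - z) ^ 2) / 2 - 1 / (1 - z) + 1 / 2 = z ^ 2 / (2 * (1 - z) ^ 2)"
      using nz by (simp add: divide_simps) (simp add: power2_eq_square algebra_simps)
    ultimately show "(\<lambda>n. b n * z ^ n) sums extremal_g \<epsilon> z"
      by (simp only: b_def extremal_g_def left_diff_distrib distrib_right mult.assoc
          times_divide_eq_left mult_1)
  qed
  have "cmod (a n) \<le> (real n + 1) / 2" "cmod (b n) \<le> (real n - 1) / 2" if "n \<ge> 2" for n
  proof -
    have "a n = - of_real ((real n + 1) / 2)" "b n = - \<epsilon> * of_real ((real n - 1) / 2)"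
      using that by (simp_all add: a_def b_def field_simps)
    then show "cmod (a n) \<le> (real n + 1) / 2" "cmod (b n) \<le> (real n - 1) / 2"
      using that assms by (simp_all only: norm_mult norm_minus_cancel norm_of_real) simp_all
  qed
  moreover have "a 0 = 0" "a 1 = 1" "b 0 = 0" "b 1 = 0"
    by (simp_all add: a_def b_def)
  ultimately show ?thesis
    using sums extremal_holomorphic unfolding coeff_class_def by blast
qed

lemma D_op_extremal:
  assumes "cmod \<epsilon> = 1" and z: "z \<in> ball 0 1"
  shows "D_op \<epsilon> (\<lambda>z. extremal_h z + cnj (extremal_g \<epsilon> z)) z
           = (2 * z - z / (1 - z) ^ 3) + cnj (z\<^sup>2 / (1 - z) ^ 3)"
proof -
  have "\<epsilon> * cnj \<epsilon> = 1"
    using assms(1) by (simp add: complex_norm_square[symmetric])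
  then have "\<epsilon> * cnj (z * (- \<epsilon> * (z / (1 - z) ^ 3))) = - cnj (z\<^sup>2 / (1 - z) ^ 3)"
    by (simp add: power2_eq_square mult.assoc[symmetric] mult.commute[of _ "cnj \<epsilon>"])
  moreover have "deriv extremal_h z = 2 - 1 / (1 - z) ^ 3"
    "deriv (extremal_g \<epsilon>) z = - \<epsilon> * (z / (1 - z) ^ 3)"
    using extremal_derivatives[OF z] by (simp_all add: DERIV_imp_deriv)
  moreover have "z * (2 - 1 / (1 - z) ^ 3) = 2 * z - z / (1 - z) ^ 3"
    by (simp add: algebra_simps)
  ultimately show ?thesis
    using D_op_harmonic[OF extremal_holomorphic refl z, of \<epsilon>] by (simp only: diff_minus_eq_add)
qed

text \<open>At the point \<open>x\<close> of the positive real axis the image value \<open>V\<close> is real and the tangent of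
  the image curve is \<open>\<i> N\<close> with \<open>N\<close> real (both up to the scaling by \<open>r\<close>), so any branch of the argument has derivative \<open>N / V\<close> there, and
  \<open>N - \<alpha> V = x * s_poly \<alpha> x / (1 - x)^4\<close> is negative. The bound \<open>x < 1 / 5\<close> keeps \<open>V\<close> positive.\<close>

lemma not_fully_starlike_extremal:
  assumes \<epsilon>: "cmod \<epsilon> = 1"
    and x: "0 < x" "x < r" "r \<le> 1" "x < 1 / 5" and neg: "s_poly \<alpha> x < 0"
  shows "\<not> fully_starlike \<alpha> (dilation r (D_op \<epsilon> (\<lambda>z. extremal_h z + cnj (extremal_g \<epsilon> z))))"
    (is "\<not> fully_starlike \<alpha> ?E")
proof
  assume "fully_starlike \<alpha> ?E"
  moreover have "x / r \<in> {0<..<1}" using x by simp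
  ultimately obtain \<phi> :: "real \<Rightarrow> real" where
    \<phi>: "\<And>\<theta>. ?E (rcis (x / r) \<theta>) = rcis (cmod (?E (rcis (x / r) \<theta>))) (\<phi> \<theta>)"
    and "\<forall>\<theta>\<in>{0..<2*pi}. \<exists>D. (\<phi> has_real_derivative D) (at \<theta>) \<and> \<alpha> < D"
    unfolding fully_starlike_def by blast
  moreover have "0 \<in> {0..<2*pi}" by simp
  ultimately obtain D where D: "(\<phi> has_real_derivative D) (at 0)" "\<alpha> < D"
    by blast
  define P Q :: "complex \<Rightarrow> complex" where "P z = 2 * z - z / (1 - z) ^ 3" and "Q z = z\<^sup>2 / (1 - z) ^ 3" for z
  have E: "?E (rcis (x / r) \<theta>) = (P (rcis x \<theta>) + cnj (Q (rcis x \<theta>))) / of_real r" for \<theta>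
  proof -
    have "of_real r * rcis (x / r) \<theta> = rcis x \<theta>"
      using x by (simp add: rcis_def)
    moreover have "rcis x \<theta> \<in> ball 0 1" using x by simp
    ultimately show ?thesis
      using D_op_extremal[OF \<epsilon>, of "rcis x \<theta>"] by (simp add: dilation_def P_def Q_def)
  qed
  define N where "N = x * (2 - (1 + 4 * x + x\<^sup>2) / (1 - x) ^ 4)"
  define V where "V = 2 * x - x / (1 - x)\<^sup>2"
  have nz: "1 - x \<noteq> 0" "complex_of_real x \<noteq> 1" using x by auto
  have "(P has_field_derivative 2 - (1 + 2 * of_real x) / (1 - of_real x) ^ 4) (at (rcis x 0))"
  proof -
    have "((\<lambda>z. z / (1 - z) ^ 3) has_field_derivative (1 + 2 * of_real x) / (1 - of_real x) ^ 4)
        (at (complex_of_real x))"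
      using nz by (auto intro!: derivative_eq_intros simp: divide_simps)
        (simp add: power_numeral_reduce algebra_simps)
    moreover have "((\<lambda>z. 2 * z) has_field_derivative 2) (at (complex_of_real x))"
      by (auto intro!: derivative_eq_intros)
    ultimately show ?thesis
      unfolding P_def[abs_def] rcis_zero_arg by (intro DERIV_diff)
  qed
  moreover have "(Q has_field_derivative (2 * of_real x + (of_real x)\<^sup>2) / (1 - of_real x) ^ 4)
      (at (rcis x 0))"
    unfolding Q_def[abs_def] rcis_zero_arg
    using nz by (auto intro!: derivative_eq_intros simp: divide_simps)
      (simp add: power_numeral_reduce algebra_simps)
  ultimately have PQ: "(P has_field_derivative 2 - (1 + 2 * of_real x) / (1 - of_real x) ^ 4)
      (at (rcis x 0))" "(Q has_field_derivative (2 * of_real x + (of_real x)\<^sup>2) / (1 - of_real x) ^ 4)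
      (at (rcis x 0))" by blast+
  from harmonic_circle_derivative[OF PQ]
  have "((\<lambda>\<theta>. P (rcis x \<theta>) + cnj (Q (rcis x \<theta>))) has_vector_derivative
      \<i> * (of_real x * (2 - (1 + 2 * of_real x) / (1 - of_real x) ^ 4)
      - cnj (of_real x * ((2 * of_real x + (of_real x)\<^sup>2) / (1 - of_real x) ^ 4)))) (at 0)"
    by simp
  also have "of_real x * (2 - (1 + 2 * of_real x) / (1 - of_real x) ^ 4)
      - cnj (of_real x * ((2 * of_real x + (of_real x)\<^sup>2) / (1 - of_real x) ^ 4))
      = complex_of_real (x * (2 - (1 + 2 * x) / (1 - x) ^ 4) - x * ((2 * x + x\<^sup>2) / (1 - x) ^ 4))"
    by simp
  also have "x * (2 - (1 + 2 * x) / (1 - x) ^ 4) - x * ((2 * x + x\<^sup>2) / (1 - x) ^ 4) = N"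
    by (simp add: N_def divide_inverse algebra_simps)
  finally have dE: "((\<lambda>\<theta>. ?E (rcis (x / r) \<theta>)) has_vector_derivative \<i> * of_real N / of_real r) (at 0)"
    unfolding E by (rule has_vector_derivative_divide)
  have E0: "?E (rcis (x / r) 0) = of_real V / of_real r"
  proof -
    have "2 * x - x / (1 - x) ^ 3 + x\<^sup>2 / (1 - x) ^ 3 = V"
      using nz by (simp add: V_def divide_simps) (simp add: power_numeral_reduce algebra_simps)
    then show ?thesis
      unfolding E by (simp add: P_def Q_def flip: of_real_eq_iff[where 'a = complex])
  qed
  have "0 < V"
  proof -
    have "(4 / 5)\<^sup>2 < (1 - x)\<^sup>2" using x by (intro power_strict_mono) auto
    then have "1 / 2 < (1 - x)\<^sup>2" by (simp add: power2_eq_square)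
    then have "1 / (1 - x)\<^sup>2 < 2"
      using nz by (simp add: pos_divide_less_eq mult.commute)
    then have "x * (1 / (1 - x)\<^sup>2) < x * 2" using x by (intro mult_strict_left_mono) auto
    then show ?thesis by (simp add: V_def)
  qed
  have "D = Im ((\<i> * of_real N / of_real r) / (of_real V / of_real r))"
    using arg_branch_derivative[OF dE _ D(1) \<phi>] E0 \<open>0 < V\<close> x by simp
  also have "\<dots> = Im (\<i> * of_real (N / V))"
    using x by simp
  also have "\<dots> = N / V" by simp
  finally have "\<alpha> * V < N"
    using mult_strict_right_mono[OF D(2) \<open>0 < V\<close>] \<open>0 < V\<close> by simp
  moreover have "N - \<alpha> * V = x * s_poly \<alpha> x / (1 - x) ^ 4"
    using nz by (simp add: N_def V_def s_poly_def divide_simps)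
      (simp add: power_numeral_reduce algebra_simps)
  moreover have "x * s_poly \<alpha> x / (1 - x) ^ 4 < 0"
    using neg x by (simp add: divide_neg_pos mult_pos_neg)
  ultimately show False by simp
qed

lemma sharp_radius_at_root:
  assumes \<alpha>: "0 \<le> \<alpha>" "\<alpha> < 1" and \<epsilon>: "cmod \<epsilon> = 1"
    and r: "r \<in> {0<..<1}" "s_poly \<alpha> r = 0"
  shows "sharp_radius (fully_starlike \<alpha>) (D_op \<epsilon>) coeff_class r"
  unfolding sharp_radius_def
proof (intro conjI ballI allI impI)
  show "0 < r" "r < 1" using r by auto
  show "fully_starlike \<alpha> (dilation r (D_op \<epsilon> f))" if "f \<in> coeff_class" for f
    using fully_starlike_dilation_D_op[OF \<alpha> \<epsilon> that] r by simp
  fix \<rho> assume \<rho>: "r < \<rho> \<and> \<rho> \<le> 1"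
  have "r < 1 / 5"
    using s_poly_root_less_tenth[OF \<alpha> r] by simp
  then obtain x where x: "r < x" "x < min \<rho> (1 / 5)"
    using \<rho> dense[of r "min \<rho> (1 / 5)"] by auto
  then have "s_poly \<alpha> x < 0"
    using s_poly_strict_antimono[OF \<alpha>, of r x] r by auto
  then show "\<not> (\<forall>f\<in>coeff_class. fully_starlike \<alpha> (dilation \<rho> (D_op \<epsilon> f)))"
    using not_fully_starlike_extremal[OF \<epsilon>, of x \<rho> \<alpha>] extremal_in_coeff_class[OF \<epsilon>] x \<rho> r by auto
qed

theorem theorem2p4:
  fixes \<alpha> :: real and \<epsilon> :: complex
  assumes "0 \<le> \<alpha>" and "\<alpha> < 1" and "cmod \<epsilon> = 1"
  shows "(\<exists>!r. r \<in> {0<..<1} \<and> s_poly \<alpha> r = 0) \<and>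
         (\<forall>r\<^sub>s. r\<^sub>s \<in> {0<..<1} \<and> s_poly \<alpha> r\<^sub>s = 0 \<longrightarrow>
            sharp_radius (fully_starlike \<alpha>) (D_op \<epsilon>) coeff_class r\<^sub>s) \<and>
         (\<exists>!r::real. r \<in> {0<..<1} \<and> 1 - 12 * r + 11 * r^2 - 8 * r^3 + 2 * r^4 = 0) \<and>
         (\<forall>r\<^sub>u::real. r\<^sub>u \<in> {0<..<1} \<and> 1 - 12 * r\<^sub>u + 11 * r\<^sub>u^2 - 8 * r\<^sub>u^3 + 2 * r\<^sub>u^4 = 0 \<longrightarrow>
            \<bar>r\<^sub>u - 0.0903331\<bar> < 0.00000005 \<and>
            sharp_radius (fully_starlike 0) (D_op \<epsilon>) coeff_class r\<^sub>u)"
proof -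
  have s0: "1 - 12 * r + 11 * r^2 - 8 * r^3 + 2 * r^4 = s_poly 0 r" for r :: real
    by (simp add: s_poly_def)
  have "\<bar>u - 0.0903331\<bar> < 0.00000005" if u: "u \<in> {0<..<1}" "s_poly 0 u = 0" for u
  proof -
    \<comment> \<open>The endpoints of the claimed interval; \<^term>\<open>s_poly 0\<close> changes sign between them.\<close>
    define l v :: real where "l = 0.09033305" and "v = 0.09033315"
    have "0 < s_poly 0 l" "s_poly 0 v < 0"
      unfolding s_poly_def l_def v_def by (simp_all add: power_numeral_reduce)
    moreover have "0 \<le> l" "l \<le> 1" "0 \<le> v" "v \<le> 1"
      by (simp_all add: l_def v_def)
    ultimately have "\<not> u \<le> l" "\<not> v \<le> u"
      using s_poly_strict_antimono[of 0 u l] s_poly_strict_antimono[of 0 v u] u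
      by (auto simp: le_less)
    then show ?thesis unfolding l_def v_def abs_less_iff by simp
  qed
  then show ?thesis
    unfolding s0
    using s_poly_root_ex1[OF assms(1,2)] s_poly_root_ex1[of 0]
      sharp_radius_at_root[OF assms] sharp_radius_at_root[of 0, OF _ _ assms(3)]
    by auto
qed

end
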